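(* Let $N \geq 2$, $\mu, \nu > 0$, $\frac{2(N+1)}{N-1} < p < 2^\ast$, and let $a, b \in L^\infty(\mathbb{R}^N)$ be $[0,1]^N$-periodic (i.e. $\mathbb{Z}^N$-periodic) with $0 \leq b(x) \leq p-1$ and $a(x) \geq a_0 > 0$ for a constant $a_0$. Let $b_+$ denote the essential supremum of $b$. Assume moreover that $p\geq4$ and $0\leq b_+ < 2^{\frac{p-2}{2}}-1$. Then every dual ground state of the functional $J_{\mu\nu}$ is semitrivial.
   Context: All functions are real-valued unless stated otherwise. $2^\ast = \frac{2N}{N-2}$ for $N\geq 3$, $2^\ast = \infty$ for $N=2$; $p' = \frac{p}{p-1}$. The bar in $\bar u,\bar v,\bar s,\bar t$ is only notation for dual variables. Function $h$: let $f(x,s,t) = \frac{a(x)}{p}\left(|s|^p + 2b(x)|s|^{\frac p2}|t|^{\frac p2} + |t|^p\right)$ for $x\in\mathbb{R}^N$, $s,t\in\mathbb{R}$. For each $x$, $h(x,\cdot,\cdot)$ is the Legendre transform of $f(x,\cdot,\cdot)$: $h(x,\bar s,\bar t) = \sup_{s,t\in\mathbb{R}}\left(s\bar s + t\bar t - f(x,s,t)\right)$. Under the assumptions on $a,b,p$ it is finite and differentiable in $(\bar s,\bar t)$. Kernel: for $\lambda>0$, $\Psi_\lambda := \mathrm{Re}\,\Phi_\lambda$ where $\Phi_\lambda(x) = \frac{i}{4}\left(\frac{\lambda}{4\pi^2|x|^2}\right)^{\frac{N-2}{4}} H^{(1)}_{\frac{N-2}{2}}(\sqrt\lambda\,|x|)$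 and $H^{(1)}_{\frac{N-2}{2}}$ is the Hankel function of the first kind. For $\frac{2(N+1)}{N-1}<p<2^\ast$, $g\mapsto \Psi_\lambda\ast g$ (defined on Schwartz functions) extends to a continuous linear operator $L^{p'}(\mathbb{R}^N)\to L^p(\mathbb{R}^N)$, again denoted $\Psi_\lambda\ast$ (known fact). Functional: $J_{\mu\nu}: L^{p'}(\mathbb{R}^N)\times L^{p'}(\mathbb{R}^N)\to\mathbb{R}$, $$J_{\mu\nu}(\bar u,\bar v) = \int_{\mathbb{R}^N} h(x,\bar u,\bar v)\,dx - \frac12\int_{\mathbb{R}^N} \left(\bar u\,(\Psi_\mu\ast\bar u) + \bar v\,(\Psi_\nu\ast\bar v)\right)dx,$$ which is well defined and continuously Fréchet differentiable. Mountain pass level: $c_{\mu\nu} := \inf_{\gamma\in\Gamma_{\mu\nu}}\sup_{0\le t\le1}J_{\mu\nu}(\gamma(t))$ with $\Gamma_{\mu\nu} := \{\gamma\in C([0,1],L^{p'}(\mathbb{R}^N)\times L^{p'}(\mathbb{R}^N)) : \gamma(0)=0,\ J_{\mu\nu}(\gamma(1))<0\}$. A dual ground state of $J_{\mu\nu}$ is a critical point $(\bar u,\bar v)$ of $J_{\mu\nu}$ with $J_{\mu\nu}(\bar u,\bar v)=c_{\mu\nu}$. It is semitrivial if $\bar u=0$ or $\bar v=0$, and fully nontrivial if both $\bar u\neq0$ and $\bar v\neq0$. *)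

theory Defs
  imports "HOL-Probability.Essential_Supremum"
begin

text \<open>The space \<open>L\<^sup>q\<close> over Euclidean space is represented by functions measurable for
  the completed Lebesgue measure. Equality of classes is equality almost everywhere, and
  all topological notions refer to the seminorm \<open>Lnorm q\<close>.\<close>

definition Lspace :: "real \<Rightarrow> (real ^ 'n \<Rightarrow> real) set" where
  "Lspace q = {u \<in> borel_measurable lebesgue. integrable lebesgue (\<lambda>x. \<bar>u x\<bar> powr q)}"

definition Lnorm :: "real \<Rightarrow> (real ^ 'n \<Rightarrow> real) \<Rightarrow> real" where
  "Lnorm q u = (\<integral>x. \<bar>u x\<bar> powr q \<partial>lebesgue) powr (1 / q)"

definition Linfty :: "(real ^ 'n \<Rightarrow> real) set" where
  "Linfty = {u \<in> borel_measurable lebesgue. esssup lebesgue (\<lambda>x. ereal \<bar>u x\<bar>) < \<infinity>}"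

definition zero_ae :: "(real ^ 'n \<Rightarrow> real) \<Rightarrow> bool" where
  "zero_ae u \<longleftrightarrow> (AE x in lebesgue. u x = 0)"

definition Zn_periodic :: "(real ^ 'n \<Rightarrow> real) \<Rightarrow> bool" where
  "Zn_periodic u \<longleftrightarrow> (\<forall>k :: real ^ 'n. (\<forall>i. k $ i \<in> \<int>) \<longrightarrow> (AE x in lebesgue. u (x + k) = u x))"

definition crit_exponent :: "nat \<Rightarrow> ereal" where
  "crit_exponent N = (if N = 2 then \<infinity> else ereal (2 * real N / (real N - 2)))"

definition conj_exponent :: "real \<Rightarrow> real" where
  "conj_exponent p = p / (p - 1)"

definition nonlin ::
    "(real ^ 'n \<Rightarrow> real) \<Rightarrow> (real ^ 'n \<Rightarrow> real) \<Rightarrow> real \<Rightarrow> real ^ 'n \<Rightarrow> real \<Rightarrow> real \<Rightarrow> real" where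
  "nonlin a b p x s t =
     a x / p * (\<bar>s\<bar> powr p + 2 * b x * \<bar>s\<bar> powr (p / 2) * \<bar>t\<bar> powr (p / 2) + \<bar>t\<bar> powr p)"

definition legendre ::
    "(real ^ 'n \<Rightarrow> real) \<Rightarrow> (real ^ 'n \<Rightarrow> real) \<Rightarrow> real \<Rightarrow> real ^ 'n \<Rightarrow> real \<Rightarrow> real \<Rightarrow> real" where
  "legendre a b p x s' t' = (SUP (s, t)\<in>UNIV. s * s' + t * t' - nonlin a b p x s t)"

text \<open>Bessel functions of real order at positive arguments. The entire function
  \<open>rGamma\<close> vanishes at the poles of \<open>Gamma\<close>, so the series also covers negative integer orders.\<close>

definition bessel_J :: "real \<Rightarrow> real \<Rightarrow> real" where
  "bessel_J \<alpha> r =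
     (\<Sum>m. (- 1) ^ m / fact m * rGamma (real m + \<alpha> + 1) * (r / 2) powr (2 * real m + \<alpha>))"

definition bessel_Y_quot :: "real \<Rightarrow> real \<Rightarrow> real" where
  "bessel_Y_quot \<alpha> r = (bessel_J \<alpha> r * cos (\<alpha> * pi) - bessel_J (- \<alpha>) r) / sin (\<alpha> * pi)"

definition bessel_Y :: "real \<Rightarrow> real \<Rightarrow> real" where
  "bessel_Y \<alpha> r =
     (if \<alpha> \<in> \<int> then Lim (at \<alpha>) (\<lambda>\<beta>. bessel_Y_quot \<beta> r) else bessel_Y_quot \<alpha> r)"

definition hankel1 :: "real \<Rightarrow> real \<Rightarrow> complex" where
  "hankel1 \<alpha> r = complex_of_real (bessel_J \<alpha> r) + \<i> * complex_of_real (bessel_Y \<alpha> r)"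

definition helmholtz_Phi :: "real \<Rightarrow> real ^ 'n \<Rightarrow> complex" where
  "helmholtz_Phi lam x =
     \<i> / 4 * complex_of_real
       ((lam / (4 * pi\<^sup>2 * (norm x)\<^sup>2)) powr ((real CARD('n) - 2) / 4))
     * hankel1 ((real CARD('n) - 2) / 2) (sqrt lam * norm x)"

definition helmholtz_Psi :: "real \<Rightarrow> real ^ 'n \<Rightarrow> real" where
  "helmholtz_Psi lam x = Re (helmholtz_Phi lam x)"

fun iter_partial :: "'n list \<Rightarrow> (real ^ 'n \<Rightarrow> real) \<Rightarrow> real ^ 'n \<Rightarrow> real" where
  "iter_partial [] g = g"
| "iter_partial (i # is) g = (\<lambda>x. frechet_derivative (iter_partial is g) (at x) (axis i 1))"

definition schwartz :: "(real ^ 'n \<Rightarrow> real) \<Rightarrow> bool" where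
  "schwartz g \<longleftrightarrow>
     (\<forall>is. (\<forall>x. iter_partial is g differentiable (at x)) \<and>
           (\<forall>k::nat. \<exists>C. \<forall>x. norm x ^ k * \<bar>iter_partial is g x\<bar> \<le> C))"

text \<open>\<open>helmholtz_conv lam p K\<close> says that \<open>K\<close> is the continuous linear operator from
  \<open>L\<^bsup>p'\<^esup>\<close> to \<open>L\<^sup>p\<close> extending convolution with \<open>helmholtz_Psi lam\<close> on Schwartz functions. Since
  these are dense, \<open>K\<close> is determined up to equality almost everywhere; it is known to exist
  if \<open>2 (N + 1) / (N - 1) < p\<close> and \<open>p\<close> is below the critical exponent.\<close>

definition helmholtz_conv ::
    "real \<Rightarrow> real \<Rightarrow> ((real ^ 'n \<Rightarrow> real) \<Rightarrow> real ^ 'n \<Rightarrow> real) \<Rightarrow> bool" where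
  "helmholtz_conv lam p K \<longleftrightarrow>
     (\<forall>u\<in>Lspace (conj_exponent p). K u \<in> Lspace p) \<and>
     (\<forall>u\<in>Lspace (conj_exponent p). \<forall>v\<in>Lspace (conj_exponent p). \<forall>c d.
        AE x in lebesgue. K (\<lambda>y. c * u y + d * v y) x = c * K u x + d * K v x) \<and>
     (\<exists>C. \<forall>u\<in>Lspace (conj_exponent p). Lnorm p (K u) \<le> C * Lnorm (conj_exponent p) u) \<and>
     (\<forall>g. schwartz g \<longrightarrow>
        (AE x in lebesgue. K g x = (\<integral>y. helmholtz_Psi lam (x - y) * g y \<partial>lebesgue)))"

type_synonym 'n fpair = "(real ^ 'n \<Rightarrow> real) \<times> (real ^ 'n \<Rightarrow> real)"

definition pair_space :: "real \<Rightarrow> 'n::finite fpair set" where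
  "pair_space q = Lspace q \<times> Lspace q"

definition pair_norm :: "real \<Rightarrow> 'n::finite fpair \<Rightarrow> real" where
  "pair_norm q z = Lnorm q (fst z) + Lnorm q (snd z)"

definition pair_lincomb :: "real \<Rightarrow> 'n::finite fpair \<Rightarrow> real \<Rightarrow> 'n fpair \<Rightarrow> 'n fpair" where
  "pair_lincomb c z d w = (\<lambda>x. c * fst z x + d * fst w x, \<lambda>x. c * snd z x + d * snd w x)"

definition has_frechet_derivative_on_pairs ::
    "real \<Rightarrow> ('n::finite fpair \<Rightarrow> real) \<Rightarrow> ('n fpair \<Rightarrow> real) \<Rightarrow> 'n fpair \<Rightarrow> bool" where
  "has_frechet_derivative_on_pairs q J D z \<longleftrightarrow>
     (\<forall>v\<in>pair_space q. \<forall>w\<in>pair_space q. \<forall>c d. D (pair_lincomb c v d w) = c * D v + d * D w) \<and>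
     (\<exists>C. \<forall>w\<in>pair_space q. \<bar>D w\<bar> \<le> C * pair_norm q w) \<and>
     (\<forall>\<epsilon>>0. \<exists>\<delta>>0. \<forall>w\<in>pair_space q. pair_norm q w < \<delta> \<longrightarrow>
        \<bar>J (pair_lincomb 1 z 1 w) - J z - D w\<bar> \<le> \<epsilon> * pair_norm q w)"

definition critical_point :: "real \<Rightarrow> ('n::finite fpair \<Rightarrow> real) \<Rightarrow> 'n fpair \<Rightarrow> bool" where
  "critical_point q J z \<longleftrightarrow>
     z \<in> pair_space q \<and> has_frechet_derivative_on_pairs q J (\<lambda>_. 0) z"

definition dual_functional ::
    "(real ^ 'n \<Rightarrow> real) \<Rightarrow> (real ^ 'n \<Rightarrow> real) \<Rightarrow> real \<Rightarrow>
     ((real ^ 'n \<Rightarrow> real) \<Rightarrow> real ^ 'n \<Rightarrow> real) \<Rightarrow> ((real ^ 'n \<Rightarrow> real) \<Rightarrow> real ^ 'n \<Rightarrow> real) \<Rightarrow>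
     'n::finite fpair \<Rightarrow> real" where
  "dual_functional a b p K\<^sub>\<mu> K\<^sub>\<nu> = (\<lambda>(u, v).
     (\<integral>x. legendre a b p x (u x) (v x) \<partial>lebesgue)
     - 1 / 2 * (\<integral>x. u x * K\<^sub>\<mu> u x + v x * K\<^sub>\<nu> v x \<partial>lebesgue))"

definition mp_paths :: "real \<Rightarrow> ('n::finite fpair \<Rightarrow> real) \<Rightarrow> (real \<Rightarrow> 'n fpair) set" where
  "mp_paths q J = {\<gamma>.
     (\<forall>t\<in>{0..1}. \<gamma> t \<in> pair_space q) \<and>
     (\<forall>t\<in>{0..1}. ((\<lambda>s. pair_norm q (pair_lincomb 1 (\<gamma> s) (- 1) (\<gamma> t))) \<longlongrightarrow> 0)
                    (at t within {0..1})) \<and>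
     zero_ae (fst (\<gamma> 0)) \<and> zero_ae (snd (\<gamma> 0)) \<and> J (\<gamma> 1) < 0}"

text \<open>Extended reals make the infimum and the suprema meaningful without
  a nonemptiness or boundedness side condition.\<close>

definition mp_level :: "real \<Rightarrow> ('n::finite fpair \<Rightarrow> real) \<Rightarrow> ereal" where
  "mp_level q J = (INF \<gamma>\<in>mp_paths q J. SUP t\<in>{0..1}. ereal (J (\<gamma> t)))"

definition dual_ground_state :: "real \<Rightarrow> ('n::finite fpair \<Rightarrow> real) \<Rightarrow> 'n fpair \<Rightarrow> bool" where
  "dual_ground_state q J z \<longleftrightarrow> critical_point q J z \<and> ereal (J z) = mp_level q J"

definition semitrivial :: "'n::finite fpair \<Rightarrow> bool" where
  "semitrivial z \<longleftrightarrow> zero_ae (fst z) \<or> zero_ae (snd z)"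

end

theory Submission
  imports Defs
begin

text \<open>Write \<open>q = p'\<close>. For \<open>p \<ge> 4\<close> the bound on \<open>b\<close> makes the nonlinearity at most
  \<open>a / p * (s\<^sup>2 + t\<^sup>2) powr (p / 2)\<close>, strictly so if \<open>s\<close> and \<open>t\<close> are both nonzero. Legendre
  duality reverses the inequality, and integrating it with Minkowski's inequality for the exponent
  \<open>2 / q\<close> gives \<open>q * H > (A powr (2 / q) + B powr (2 / q)) powr (q / 2)\<close> for every fully nontrivial
  pair \<open>(u, v)\<close>, where \<open>H\<close> is the integral of the transform and \<open>A\<close>, \<open>B\<close> are the integrals of
  \<open>a powr (1 - q) * \<bar>u\<bar> powr q\<close> and \<open>a powr (1 - q) * \<bar>v\<bar> powr q\<close>.

  At a critical point \<open>Z = q * H\<close> equals the quadratic form, so that the energy is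
  \<open>(1 / q - 1 / 2) * Z\<close>. If this is the mountain pass level, then comparison with the rays through
  \<open>(u, 0)\<close> and \<open>(0, v)\<close> bounds the two parts of the quadratic form by
  \<open>A powr (2 / q) * Z powr (1 - 2 / q)\<close> and \<open>B powr (2 / q) * Z powr (1 - 2 / q)\<close>. Adding these
  bounds contradicts the strict inequality.\<close>

subsection \<open>Power inequalities\<close>

text \<open>Bernoulli's inequality, obtained as Young's inequality for the product
  \<open>x * 1\<close> with exponents \<open>k\<close> and \<open>k / (k - 1)\<close>; the conjugate
  exponent forces the separate case \<open>k = 1\<close>.\<close>

lemma powr_ge_tangent:
  fixes x k :: real
  assumes "x \<ge> 0" "k \<ge> 1"
  shows "1 + k * (x - 1) \<le> x powr k"
proof (cases "k = 1")
  case False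
  have "x * 1 \<le> x powr k / k + 1 powr (k / (k - 1)) / (k / (k - 1))"
    using assms False by (intro Youngs_inequality) (auto simp: diff_divide_distrib)
  then have "k * x \<le> k * (x powr k / k + (k - 1) / k)"
    using assms by (intro mult_left_mono) auto
  also have "\<dots> = x powr k + (k - 1)"
    using assms by (simp add: distrib_left)
  finally show ?thesis
    by (simp add: algebra_simps)
qed (use assms in auto)

text \<open>Jensen's inequality for \<open>x powr k\<close> with weights \<open>1 - t\<close>, \<open>t\<close> at the points
  \<open>1 + t\<close>, \<open>t\<close>, whose mean is \<open>1\<close>.\<close>

lemma one_le_powr_combination:
  fixes t m :: real
  assumes "0 \<le> t" "t \<le> 1" "m \<ge> 2"
  shows "1 \<le> (1 + t) powr (m - 1) * (1 - t) + t powr m"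
proof -
  have "(1 + (m - 1) * t) * (1 - t) \<le> (1 + t) powr (m - 1) * (1 - t)"
    using powr_ge_tangent[of "1 + t" "m - 1"] assms by (intro mult_right_mono) auto
  moreover have "(1 + (m - 1) * (t - 1)) * t \<le> t powr (m - 1) * t"
    using powr_ge_tangent[of t "m - 1"] assms by (intro mult_right_mono) auto
  moreover have "t powr (m - 1) * t = t powr m"
    using assms by (cases "t = 0") (auto simp: powr_diff)
  ultimately show ?thesis
    by (simp add: algebra_simps)
qed

text \<open>This is the case of geometric mean 1 of the next inequality. Both sides equal
  \<open>2 powr m + (2 powr m - 2) - (2 powr m - 2)\<close> at \<open>x = 1\<close>, and their
  difference is nondecreasing from there on.\<close>

lemma powr_sum_inverse_ge:
  fixes x m :: real
  assumes "x \<ge> 1" "m \<ge> 2"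
  shows "x powr m + x powr (- m) + (2 powr m - 2) \<le> (x + 1 / x) powr m"
proof -
  define F where "F = (\<lambda>x::real. (x + 1 / x) powr m - x powr m - x powr (- m))"
  have "F 1 \<le> F x"
  proof (rule DERIV_nonneg_imp_nondecreasing[OF \<open>x \<ge> 1\<close>])
    fix y :: real assume y: "1 \<le> y" "y \<le> x"
    define D where "D = m * (y + 1 / y) powr (m - 1) * (1 - 1 / y\<^sup>2)
        - m * y powr (m - 1) + m * y powr (- m - 1)"
    have pos: "y + 1 / y > 0" using y by (simp add: add_pos_pos)
    have "(F has_real_derivative D) (at y)"
      unfolding F_def D_def using y pos
      by (auto intro!: derivative_eq_intros simp: power2_eq_square field_simps)
    moreover have "D \<ge> 0"
    proof -
      \<comment> \<open>In terms of \<open>t\<close> the derivative is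
        \<open>m * y powr (m - 1)\<close> times the difference of the two sides of
        \<open>one_le_powr_combination\<close>.\<close>
      define t where "t = 1 / y\<^sup>2"
      have t: "0 \<le> t" "t \<le> 1" using y by (auto simp: t_def)
      have "y + 1 / y = y * (1 + t)"
        using y by (simp add: t_def field_simps power2_eq_square)
      moreover have "y powr (- m - 1) = y powr (m - 1) * t powr m"
      proof -
        have "t = y powr (-2)" using y by (simp add: t_def powr_minus divide_inverse)
        then show ?thesis using y by (simp add: powr_powr flip: powr_add)
      qed
      ultimately have "D = m * y powr (m - 1) * ((1 + t) powr (m - 1) * (1 - t) + t powr m - 1)"
        using y t unfolding D_def t_def[symmetric]
        by (simp only: powr_mult) (simp add: algebra_simps)
      then show ?thesis
        using one_le_powr_combination[OF t \<open>m \<ge> 2\<close>] \<open>m \<ge> 2\<close> by simp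
    qed
    ultimately show "\<exists>D. (F has_real_derivative D) (at y) \<and> 0 \<le> D" by blast
  qed
  then show ?thesis by (simp add: F_def)
qed

text \<open>By symmetry and homogeneity: dividing by the geometric mean \<open>c\<close> turns the
  pair into \<open>x\<close> and \<open>1 / x\<close> with \<open>x \<ge> 1\<close>. The coefficient
  \<open>2 powr m - 2\<close> is the best possible, since \<open>X = Y\<close> gives
  equality.\<close>

lemma powr_add_ge:
  fixes X Y m :: real
  assumes "X > 0" "Y > 0" "m \<ge> 2"
  shows "X powr m + (2 powr m - 2) * (X powr (m / 2) * Y powr (m / 2)) + Y powr m
    \<le> (X + Y) powr m"
proof -
  have *: "X powr m + (2 powr m - 2) * (X powr (m / 2) * Y powr (m / 2)) + Y powr m
    \<le> (X + Y) powr m" if "Y \<le> X" "Y > 0" for X Y :: real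
  proof -
    define c x where "c = sqrt (X * Y)" and "x = sqrt (X / Y)"
    have c: "c > 0" and x: "x \<ge> 1" using that by (auto simp: c_def x_def)
    have X: "X = c * x" and Y: "Y = c * (1 / x)"
      using that by (auto simp: c_def x_def real_sqrt_mult real_sqrt_divide)
    have XY: "X powr (m / 2) * Y powr (m / 2) = c powr m"
      using c x by (simp add: X Y powr_divide powr_mult flip: powr_add)
    have "c powr m * (x powr m + x powr (- m) + (2 powr m - 2))
        \<le> c powr m * (x + 1 / x) powr m"
      by (intro mult_left_mono powr_sum_inverse_ge x assms) auto
    moreover have "c powr m * (x + 1 / x) powr m = (X + Y) powr m"
      using c x by (simp add: X Y ring_distribs flip: powr_mult)
    moreover have "c powr m * x powr m = X powr m" "c powr m * x powr (- m) = Y powr m"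
      using c x by (simp_all add: X Y powr_mult powr_divide powr_minus field_simps)
    ultimately show ?thesis by (simp add: XY algebra_simps)
  qed
  show ?thesis
    using *[of Y X] *[of X Y] assms by (cases "Y \<le> X") (auto simp: algebra_simps)
qed

text \<open>Here \<open>powr_add_ge\<close> is applied to the squares with \<open>m = p / 2\<close>,
  so \<open>p \<ge> 4\<close> is the condition \<open>m \<ge> 2\<close>. The bound on \<beta> says
  that \<open>2 * \<beta>\<close> lies strictly below the best coefficient
  \<open>2 powr (p / 2) - 2\<close>.\<close>

lemma coupled_power_le:
  fixes s t \<beta> p :: real
  assumes "p \<ge> 4" "\<beta> < 2 powr ((p - 2) / 2) - 1"
  shows "\<bar>s\<bar> powr p + 2 * \<beta> * \<bar>s\<bar> powr (p / 2) * \<bar>t\<bar> powr (p / 2) + \<bar>t\<bar> powr p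
      \<le> (s\<^sup>2 + t\<^sup>2) powr (p / 2)" (is "?L \<le> ?R")
    and "s \<noteq> 0 \<Longrightarrow> t \<noteq> 0 \<Longrightarrow>
      \<bar>s\<bar> powr p + 2 * \<beta> * \<bar>s\<bar> powr (p / 2) * \<bar>t\<bar> powr (p / 2) + \<bar>t\<bar> powr p
      < (s\<^sup>2 + t\<^sup>2) powr (p / 2)"
proof -
  have sq: "(r\<^sup>2) powr e = \<bar>r\<bar> powr (2 * e)" for r e :: real
  proof -
    have "\<bar>r\<bar> powr 2 = r\<^sup>2" by (cases "r = 0") auto
    then show ?thesis by (metis powr_powr)
  qed
  show strict: "?L < ?R" if "s \<noteq> 0" "t \<noteq> 0"
  proof -
    have "2 * (2 powr ((p - 2) / 2)) = (2::real) powr (p / 2)"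
      by (simp add: powr_diff diff_divide_distrib)
    then have "2 * \<beta> < 2 powr (p / 2) - 2" using assms(2) by linarith
    then have "2 * \<beta> * (\<bar>s\<bar> powr (p / 2) * \<bar>t\<bar> powr (p / 2))
        < (2 powr (p / 2) - 2) * (\<bar>s\<bar> powr (p / 2) * \<bar>t\<bar> powr (p / 2))"
      using that by (intro mult_strict_right_mono) auto
    with powr_add_ge[of "s\<^sup>2" "t\<^sup>2" "p / 2"] that assms show ?thesis
      by (simp add: sq algebra_simps)
  qed
  \<comment> \<open>If one argument is zero, the coupling term vanishes and both sides
    agree.\<close>
  show "?L \<le> ?R"
    using strict assms by (cases "s = 0 \<or> t = 0") (auto simp: sq)
qed

subsection \<open>Pointwise bounds for the Legendre transform\<close>

lemma conj_exponent_identities: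
  fixes p q :: real
  assumes "p > 1" "q = conj_exponent p"
  shows "q > 1" "1 / p + 1 / q = 1" "p * (q - 1) = q"
proof -
  have p: "p - 1 > 0" using assms by simp
  then show "q > 1" by (simp add: assms conj_exponent_def)
  have "p / (p - 1) - 1 = 1 / (p - 1)"
    using p by (simp add: divide_simps)
  then have "p * (p / (p - 1) - 1) = p / (p - 1)" by simp
  then show pq: "p * (q - 1) = q" by (simp add: assms conj_exponent_def)
  show "1 / p + 1 / q = 1"
    using p \<open>q > 1\<close> pq by (simp add: add_divide_eq_iff algebra_simps)
qed

text \<open>Since \<open>b\<close> is nonnegative, dropping the coupling term only increases the
  left side; what remains splits into two instances of Young's inequality.\<close>

lemma legendre_term_le:
  fixes a b :: "real ^ 'n \<Rightarrow> real"
  assumes "p > 1" "a x > 0" "b x \<ge> 0" and q: "q = conj_exponent p"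
  shows "s * s' + t * t' - nonlin a b p x s t
    \<le> a x powr (1 - q) / q * (\<bar>s'\<bar> powr q + \<bar>t'\<bar> powr q)"
proof -
  note q1 = conj_exponent_identities(1)[OF \<open>p > 1\<close> q]
    and pq = conj_exponent_identities(2,3)[OF \<open>p > 1\<close> q]
  have "q / p = q - 1" using pq(2) \<open>p > 1\<close> by (simp add: divide_eq_eq mult.commute)
  have young: "r * r' \<le> a x / p * \<bar>r\<bar> powr p + a x powr (1 - q) / q * \<bar>r'\<bar> powr q" for r r' :: real
  proof -
    have "r * r' \<le> \<bar>r\<bar> * \<bar>r'\<bar>" by (metis abs_ge_self abs_mult)
    \<comment> \<open>The inserted factors are inverse to each other: the first becomes
      \<open>a x\<close> in the power \<open>p\<close>, the second \<open>a x powr (1 - q)\<close>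
      in the power \<open>q\<close>, because \<open>q / p = q - 1\<close>.\<close>
    also have "\<dots> = (a x powr (1 / p) * \<bar>r\<bar>) * (a x powr (- 1 / p) * \<bar>r'\<bar>)"
      using assms by (simp add: powr_minus field_simps)
    also have "\<dots> \<le> (a x powr (1 / p) * \<bar>r\<bar>) powr p / p + (a x powr (- 1 / p) * \<bar>r'\<bar>) powr q / q"
      using assms q1 pq by (intro Youngs_inequality) auto
    also have "\<dots> = a x / p * \<bar>r\<bar> powr p + a x powr (1 - q) / q * \<bar>r'\<bar> powr q"
      using assms \<open>q / p = q - 1\<close> by (simp add: powr_mult powr_powr)
    finally show ?thesis .
  qed
  have "a x / p * (2 * b x * \<bar>s\<bar> powr (p / 2) * \<bar>t\<bar> powr (p / 2)) \<ge> 0"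
    using assms by simp
  then show ?thesis
    using young[of s s'] young[of t t'] by (simp add: nonlin_def algebra_simps)
qed

text \<open>The supremum in \<open>legendre\<close> is a real one, so comparing it with its terms
  requires this bound.\<close>

lemma legendre_bdd_above:
  fixes a b :: "real ^ 'n \<Rightarrow> real"
  assumes "p > 1" "a x > 0" "b x \<ge> 0"
  shows "bdd_above (range (\<lambda>(s, t). s * s' + t * t' - nonlin a b p x s t))"
  using legendre_term_le[of p a x b, OF assms refl]
  by (intro bdd_aboveI) auto

lemma legendre_upper:
  fixes a b :: "real ^ 'n \<Rightarrow> real"
  assumes "p > 1" "a x > 0" "b x \<ge> 0" "q = conj_exponent p"
  shows "legendre a b p x s' t' \<le> a x powr (1 - q) / q * (\<bar>s'\<bar> powr q + \<bar>t'\<bar> powr q)"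
  unfolding legendre_def using legendre_term_le[of p a x b q, OF assms]
  by (intro cSUP_least) auto

lemma legendre_ge_term:
  fixes a b :: "real ^ 'n \<Rightarrow> real"
  assumes "p > 1" "a x > 0" "b x \<ge> 0"
  shows "s * s' + t * t' - nonlin a b p x s t \<le> legendre a b p x s' t'"
  unfolding legendre_def
  using cSUP_upper[OF UNIV_I legendre_bdd_above[of p a x b s' t', OF assms], of "(s, t)"] by simp

lemma legendre_nonneg:
  fixes a b :: "real ^ 'n \<Rightarrow> real"
  assumes "p > 1" "a x > 0" "b x \<ge> 0"
  shows "0 \<le> legendre a b p x s' t'"
  using legendre_ge_term[of p a x b 0 s' 0 t', OF assms] assms by (simp add: nonlin_def)

text \<open>The transform of a function homogeneous of degree \<open>p\<close> is homogeneous of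
  degree \<open>q\<close>. Substituting \<open>r powr (q - 1)\<close> times the arguments makes
  linear and nonlinear parts scale alike, as \<open>(q - 1) * p = q\<close>.\<close>

lemma legendre_scale:
  fixes a b :: "real ^ 'n \<Rightarrow> real"
  assumes "p > 1" "a x > 0" "b x \<ge> 0" "q = conj_exponent p" "r > 0"
  shows "legendre a b p x (r * s') (r * t') = r powr q * legendre a b p x s' t'"
proof -
  have le: "legendre a b p x (r * s') (r * t') \<le> r powr q * legendre a b p x s' t'"
    if r: "r > 0" for r s' t' :: real
    unfolding legendre_def[of a b p x "r * s'"]
  proof (rule cSUP_least)
    fix z :: "real \<times> real"
    obtain s t where z: "z = (s, t)" by (cases z)
    define \<sigma> \<rho> where "\<sigma> = s / r powr (q - 1)" and "\<rho> = t / r powr (q - 1)"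
    have st: "s = r powr (q - 1) * \<sigma>" "t = r powr (q - 1) * \<rho>"
      using r by (auto simp: \<sigma>_def \<rho>_def)
    have q: "(q - 1) * p = q" "r powr (q - 1) * r = r powr q"
      using conj_exponent_identities(3)[of p q] assms r by (auto simp: powr_diff mult.commute)
    have "nonlin a b p x s t = r powr q * nonlin a b p x \<sigma> \<rho>"
    proof -
      have 1: "\<bar>r powr (q - 1) * y\<bar> powr p = r powr q * \<bar>y\<bar> powr p" for y
        using r q by (simp add: abs_mult powr_mult powr_powr)
      have 2: "\<bar>r powr (q - 1) * y\<bar> powr (p / 2) = r powr (q / 2) * \<bar>y\<bar> powr (p / 2)" for y
        using r q by (simp add: abs_mult powr_mult powr_powr)
      have 3: "r powr (q / 2) * r powr (q / 2) = r powr q"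
        by (simp flip: powr_add)
      show ?thesis
        unfolding nonlin_def st 1 2 3[symmetric] by (simp add: algebra_simps)
    qed
    moreover have "s * (r * s') = r powr q * (\<sigma> * s')" "t * (r * t') = r powr q * (\<rho> * t')"
      unfolding st q(2)[symmetric] by simp_all
    ultimately have "s * (r * s') + t * (r * t') - nonlin a b p x s t
        = r powr q * (\<sigma> * s' + \<rho> * t' - nonlin a b p x \<sigma> \<rho>)"
      by (simp only: ring_distribs)
    also have "\<dots> \<le> r powr q * legendre a b p x s' t'"
      using legendre_ge_term[of p a x b] assms by (intro mult_left_mono) auto
    finally show "(case z of (s, t) \<Rightarrow> s * (r * s') + t * (r * t') - nonlin a b p x s t)
        \<le> r powr q * legendre a b p x s' t'" by (simp add: z)
  qed auto
  \<comment> \<open>The reverse inequality is the same bound for the factor \<open>1 / r\<close> at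
    the scaled point.\<close>
  have "r powr q * legendre a b p x s' t' \<le> legendre a b p x (r * s') (r * t')"
    using le[of "1 / r" "r * s'" "r * t'"] \<open>r > 0\<close> by (simp add: powr_divide field_simps)
  with le[of r s' t'] \<open>r > 0\<close> show ?thesis by simp
qed

text \<open>The test point is the maximizer for the majorant \<open>a x / p * (s\<^sup>2 + t\<^sup>2) powr (p / 2)\<close> of
  the nonlinearity, whose transform is the right-hand side.\<close>

lemma legendre_lower:
  fixes a b :: "real ^ 'n \<Rightarrow> real"
  assumes "p \<ge> 4" "a x > 0" "b x \<ge> 0" "b x < 2 powr ((p - 2) / 2) - 1" "q = conj_exponent p"
  shows "a x powr (1 - q) / q * (s'\<^sup>2 + t'\<^sup>2) powr (q / 2) \<le> legendre a b p x s' t'"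
    and "s' \<noteq> 0 \<Longrightarrow> t' \<noteq> 0 \<Longrightarrow>
      a x powr (1 - q) / q * (s'\<^sup>2 + t'\<^sup>2) powr (q / 2) < legendre a b p x s' t'"
proof -
  \<comment> \<open>The factor \<tau> solves
    \<open>a x * \<tau> powr (p - 1) * R powr (p / 2 - 1) = 1\<close> for \<open>R > 0\<close>,
    which says that the gradient of the majorant at \<open>(\<tau> * s', \<tau> * t')\<close> is
    \<open>(s', t')\<close>.\<close>
  define R \<tau> where "R = s'\<^sup>2 + t'\<^sup>2" and "\<tau> = a x powr (1 - q) * R powr (q / 2 - 1)"
  have q: "p * (1 - q) = - q" "p * (q - 1) = q" "1 - 1 / p = 1 / q" "q > 1"
    using conj_exponent_identities[of p q] assms by (auto simp: algebra_simps)
  have R: "R \<ge> 0" by (simp add: R_def)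
  have eq: "(\<tau> * s') * s' + (\<tau> * t') * t' - a x / p * ((\<tau> * s')\<^sup>2 + (\<tau> * t')\<^sup>2) powr (p / 2)
      = a x powr (1 - q) / q * R powr (q / 2)"
  proof (cases "R = 0")
    case False
    then have R: "R > 0" using R by simp
    have \<tau>: "\<tau> > 0" using R assms by (simp add: \<tau>_def)
    have "(\<tau> * s')\<^sup>2 + (\<tau> * t')\<^sup>2 = \<tau>\<^sup>2 * R"
      by (simp add: R_def power_mult_distrib algebra_simps)
    then have "((\<tau> * s')\<^sup>2 + (\<tau> * t')\<^sup>2) powr (p / 2) = \<tau> powr p * R powr (p / 2)"
      using \<tau> R by (simp add: powr_mult powr_powr flip: powr_numeral)
    also have "\<tau> powr p = a x powr (- q) * R powr (q / 2 * p - p)"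
    proof -
      have "(1 - q) * p = - q" "(q / 2 - 1) * p = q / 2 * p - p"
        using q by (auto simp: algebra_simps)
      then show ?thesis
        using R assms by (simp add: \<tau>_def powr_mult powr_powr)
    qed
    also have "a x powr (- q) * R powr (q / 2 * p - p) * R powr (p / 2)
        = a x powr (- q) * R powr (q / 2)"
    proof -
      have "q / 2 * p - p + p / 2 = q / 2" using q by (simp add: algebra_simps)
      then show ?thesis by (metis mult.assoc powr_add)
    qed
    finally have "a x / p * ((\<tau> * s')\<^sup>2 + (\<tau> * t')\<^sup>2) powr (p / 2)
        = (a x * a x powr (- q)) * R powr (q / 2) / p" by simp
    also have "a x * a x powr (- q) = a x powr (1 - q)"
      using assms by (simp add: powr_diff powr_minus field_simps)
    finally have 1: "a x / p * ((\<tau> * s')\<^sup>2 + (\<tau> * t')\<^sup>2) powr (p / 2)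
        = a x powr (1 - q) * R powr (q / 2) / p" .
    have "(\<tau> * s') * s' + (\<tau> * t') * t' = \<tau> * R"
      by (simp add: R_def power2_eq_square algebra_simps)
    also have "\<dots> = a x powr (1 - q) * R powr (q / 2)"
      using R by (simp add: \<tau>_def powr_diff)
    finally have "(\<tau> * s') * s' + (\<tau> * t') * t' - a x / p * ((\<tau> * s')\<^sup>2 + (\<tau> * t')\<^sup>2) powr (p / 2)
        = a x powr (1 - q) * R powr (q / 2) * (1 - 1 / p)"
      unfolding 1 by (simp add: right_diff_distrib)
    with q show ?thesis by simp
  qed (auto simp: R_def add_nonneg_eq_0_iff \<tau>_def)
  have le: "(\<tau> * s') * s' + (\<tau> * t') * t' - nonlin a b p x (\<tau> * s') (\<tau> * t') \<le> legendre a b p x s' t'"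
    using legendre_ge_term[of p a x b "\<tau> * s'" s' "\<tau> * t'" t'] assms by simp
  have "nonlin a b p x (\<tau> * s') (\<tau> * t') \<le> a x / p * ((\<tau> * s')\<^sup>2 + (\<tau> * t')\<^sup>2) powr (p / 2)"
    unfolding nonlin_def using assms by (intro mult_left_mono coupled_power_le) auto
  with le eq show "a x powr (1 - q) / q * (s'\<^sup>2 + t'\<^sup>2) powr (q / 2) \<le> legendre a b p x s' t'"
    by (simp add: R_def)
  assume "s' \<noteq> 0" "t' \<noteq> 0"
  moreover from this have "\<tau> \<noteq> 0" using assms by (simp add: \<tau>_def R_def add_nonneg_eq_0_iff)
  ultimately have "nonlin a b p x (\<tau> * s') (\<tau> * t')
      < a x / p * ((\<tau> * s')\<^sup>2 + (\<tau> * t')\<^sup>2) powr (p / 2)"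
    unfolding nonlin_def using assms by (intro mult_strict_left_mono coupled_power_le) auto
  with le eq show "a x powr (1 - q) / q * (s'\<^sup>2 + t'\<^sup>2) powr (q / 2) < legendre a b p x s' t'"
    by (simp add: R_def)
qed

subsection \<open>The mountain pass level along rays\<close>

text \<open>The quadratic coefficient is parametrized so that the left side, as a function of
  \<tau>, is maximal where \<open>\<tau> powr q * A = W\<close>, with value
  \<open>(1 / q - 1 / 2) * W\<close>. With \<open>y\<close> the ratio of these two quantities, the
  bound is the tangent inequality for \<open>y powr (2 / q)\<close> at \<open>y = 1\<close>.\<close>

lemma powr_ray_le:
  fixes q A W \<tau> :: real
  assumes "1 < q" "q < 2" "A > 0" "W > 0" "\<tau> \<ge> 0"
  shows "\<tau> powr q * A / q - \<tau>\<^sup>2 / 2 * (A powr (2 / q) * W powr (1 - 2 / q)) \<le> (1 / q - 1 / 2) * W"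
proof -
  define y where "y = \<tau> powr q * A / W"
  have y: "y \<ge> 0" using assms by (simp add: y_def)
  have "(1 + 2 / q * (y - 1)) * W \<le> y powr (2 / q) * W"
    using assms by (intro mult_right_mono powr_ge_tangent y) auto
  also have "y powr (2 / q) * W = \<tau>\<^sup>2 * (A powr (2 / q) * W powr (1 - 2 / q))"
  proof -
    have "(\<tau> powr q) powr (2 / q) = \<tau>\<^sup>2"
      using assms by (cases "\<tau> = 0") (auto simp: powr_powr)
    then show ?thesis
      using assms by (simp add: y_def powr_mult powr_divide powr_diff)
  qed
  finally have "W + 2 / q * (y * W - W) \<le> \<tau>\<^sup>2 * (A powr (2 / q) * W powr (1 - 2 / q))"
    (is "_ \<le> \<tau>\<^sup>2 * ?X") by (simp add: algebra_simps)
  moreover have "2 / q * (y * W - W) = 2 * (\<tau> powr q * A / q - W / q)"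
    using assms by (simp add: y_def diff_divide_distrib)
  ultimately have "W + 2 * (\<tau> powr q * A / q - W / q) \<le> \<tau>\<^sup>2 * ?X"
    by simp
  moreover have "t - y / 2 \<le> w - W / 2" if "W + 2 * (t - w) \<le> y" for t w y :: real
    using that by simp
  ultimately have "\<tau> powr q * A / q - (\<tau>\<^sup>2 * ?X) / 2 \<le> W / q - W / 2"
    by blast
  then show ?thesis by (simp add: left_diff_distrib)
qed

lemma Lnorm_mult:
  assumes "q > 0"
  shows "Lnorm q (\<lambda>x. c * u x) = \<bar>c\<bar> * Lnorm q u"
proof -
  have "(\<integral>x. \<bar>u x\<bar> powr q \<partial>lebesgue) \<ge> 0" by simp
  then show ?thesis
    using assms by (simp add: Lnorm_def abs_mult powr_mult powr_powr)
qed

lemma Lspace_mult: "u \<in> Lspace q \<Longrightarrow> (\<lambda>x. c * u x) \<in> Lspace q"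
  by (auto simp: Lspace_def abs_mult powr_mult)

lemma zero_in_Lspace: "(\<lambda>x. 0) \<in> Lspace q"
  by (simp add: Lspace_def)

lemma pair_lincomb_scale: "pair_lincomb c (u, v) 0 (u', v') = (\<lambda>x. c * u x, \<lambda>x. c * v x)"
  by (simp add: pair_lincomb_def)

lemma pair_norm_scale:
  "q > 0 \<Longrightarrow> pair_norm q (\<lambda>x. c * u x, \<lambda>x. c * v x) = \<bar>c\<bar> * pair_norm q (u, v)"
  by (simp add: pair_norm_def Lnorm_mult distrib_left)

lemma pair_norm_nonneg: "pair_norm q z \<ge> 0"
  by (simp add: pair_norm_def Lnorm_def)

text \<open>The straight path through a far multiple of \<open>w\<close> is admissible.\<close>

lemma mp_level_le_ray:
  fixes w :: "'n::finite fpair"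
  assumes q: "1 < q" "q < 2" and w: "w \<in> pair_space q" and pos: "A > 0" "Q > 0"
    and J: "\<And>\<tau>. \<tau> \<ge> 0 \<Longrightarrow> J (pair_lincomb \<tau> w 0 w) \<le> \<tau> powr q * A / q - \<tau>\<^sup>2 / 2 * Q"
    and C: "\<And>\<tau>. \<tau> \<ge> 0 \<Longrightarrow> \<tau> powr q * A / q - \<tau>\<^sup>2 / 2 * Q \<le> C"
  shows "mp_level q J \<le> ereal C"
proof -
  obtain u v where uv: "w = (u, v)" by (cases w)
  \<comment> \<open>The majorant on the ray vanishes where
    \<open>\<tau> powr (2 - q) = 2 * A / (q * Q)\<close>; the added 1 puts \<open>T\<close> beyond
    that point.\<close>
  define T where "T = (2 * A / (q * Q) + 1) powr (1 / (2 - q))"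
  define \<gamma> where "\<gamma> = (\<lambda>t. pair_lincomb (t * T) w 0 w)"
  have base: "2 * A / (q * Q) + 1 > 0" using q pos by (simp add: add_pos_pos)
  have T: "T > 0" using base by (simp add: T_def)
  have "J (\<gamma> 1) < 0"
  proof -
    have "T powr (2 - q) = 2 * A / (q * Q) + 1"
      using base q by (simp add: T_def powr_powr)
    then have "A / q < T powr (2 - q) * (Q / 2)"
      using q pos by (simp add: field_simps)
    then have "T powr q * (A / q) < T powr q * (T powr (2 - q) * (Q / 2))"
      using T by (intro mult_strict_left_mono) auto
    also have "\<dots> = T\<^sup>2 / 2 * Q"
      using T by (simp add: powr_diff)
    finally have "T powr q * A / q < T\<^sup>2 / 2 * Q"
      unfolding times_divide_eq_right .
    moreover have "J (\<gamma> 1) \<le> T powr q * A / q - T\<^sup>2 / 2 * Q"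
      using J[of T] T by (simp add: \<gamma>_def)
    ultimately show ?thesis by linarith
  qed
  moreover have "\<gamma> t \<in> pair_space q" for t
    using w by (simp add: \<gamma>_def uv pair_lincomb_scale pair_space_def Lspace_mult)
  moreover have "((\<lambda>s. pair_norm q (pair_lincomb 1 (\<gamma> s) (- 1) (\<gamma> t))) \<longlongrightarrow> 0) (at t within {0..1})" for t
  proof -
    have "pair_lincomb 1 (\<gamma> s) (- 1) (\<gamma> t) = (\<lambda>x. (s - t) * T * u x, \<lambda>x. (s - t) * T * v x)" for s
      by (simp add: \<gamma>_def uv pair_lincomb_def algebra_simps)
    then have "pair_norm q (pair_lincomb 1 (\<gamma> s) (- 1) (\<gamma> t)) = \<bar>(s - t) * T\<bar> * pair_norm q (u, v)" for s
      using q pair_norm_scale[of q "(s - t) * T" u v] by simp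
    moreover have "((\<lambda>s. \<bar>(s - t) * T\<bar> * pair_norm q (u, v)) \<longlongrightarrow> \<bar>(t - t) * T\<bar> * pair_norm q (u, v))
        (at t within {0..1})"
      by (intro tendsto_intros)
    ultimately show ?thesis by simp
  qed
  moreover have "zero_ae (fst (\<gamma> 0))" "zero_ae (snd (\<gamma> 0))"
    by (auto simp: \<gamma>_def uv pair_lincomb_scale zero_ae_def)
  ultimately have "\<gamma> \<in> mp_paths q J" by (simp add: mp_paths_def)
  then have "mp_level q J \<le> (SUP t\<in>{0..1}. ereal (J (\<gamma> t)))"
    unfolding mp_level_def by (rule INF_lower)
  also have "\<dots> \<le> ereal C"
  proof (rule SUP_least)
    fix t :: real assume "t \<in> {0..1}"
    then have "t * T \<ge> 0" using T by simp
    from J[OF this] C[OF this] show "ereal (J (\<gamma> t)) \<le> ereal C"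
      by (simp add: \<gamma>_def)
  qed
  finally show ?thesis .
qed

text \<open>A larger \<open>Q\<close> would lower the maximum of \<open>J\<close> on the ray through
  \<open>w\<close> below the mountain pass level. The negated claim also makes \<open>Q\<close>
  positive, so that the ray does reach negative values.\<close>

lemma form_le_of_mp_level:
  fixes w :: "'n::finite fpair"
  assumes q: "1 < q" "q < 2" and w: "w \<in> pair_space q" and pos: "A > 0" "Z > 0"
    and J: "\<And>\<tau>. \<tau> \<ge> 0 \<Longrightarrow> J (pair_lincomb \<tau> w 0 w) \<le> \<tau> powr q * A / q - \<tau>\<^sup>2 / 2 * Q"
    and level: "ereal ((1 / q - 1 / 2) * Z) = mp_level q J"
  shows "Q \<le> A powr (2 / q) * Z powr (1 - 2 / q)"
proof (rule ccontr)
  assume neg: "\<not> ?thesis"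
  then have Q: "Q > 0" using pos by (smt (verit) powr_ge_zero mult_nonneg_nonneg)
  \<comment> \<open>\<open>W\<close> is the solution of
    \<open>Q = A powr r * W powr (1 - r)\<close>, which brings \<open>Q\<close> into the form
    required by \<open>powr_ray_le\<close>.\<close>
  define r W where "r = 2 / q" and "W = (A powr r / Q) powr (1 / (r - 1))"
  have r: "r > 1" using q by (simp add: r_def)
  have W: "W > 0" using pos Q by (simp add: W_def)
  have "W powr (1 - r) = (A powr r / Q) powr (- 1)"
  proof -
    have "1 / (r - 1) * (1 - r) = - 1" using r by (simp add: divide_eq_eq)
    then show ?thesis by (simp only: W_def powr_powr)
  qed
  also have "\<dots> = Q / A powr r" using pos Q by (simp add: powr_minus field_simps)
  finally have QW: "Q = A powr r * W powr (1 - r)" using pos by simp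
  have "mp_level q J \<le> ereal ((1 / q - 1 / 2) * W)"
    using powr_ray_le[OF q \<open>A > 0\<close> W]
    by (intro mp_level_le_ray[OF q w \<open>A > 0\<close> Q J]) (auto simp: QW r_def)
  then have "(1 / q - 1 / 2) * Z \<le> (1 / q - 1 / 2) * W" by (simp flip: level)
  moreover have "1 / q - 1 / 2 > 0" using q by (simp add: field_simps)
  ultimately have "Z \<le> W" by (simp only: mult_le_cancel_left_pos)
  then have "W powr (1 - r) \<le> Z powr (1 - r)"
    using r pos by (intro powr_mono2') auto
  then have "Q \<le> A powr r * Z powr (1 - r)"
    unfolding QW using pos by (intro mult_left_mono) auto
  with neg show False by (simp add: r_def)
qed

text \<open>The Nehari identity: the derivative of \<open>J\<close> along the ray through
  \<open>z\<close> vanishes at parameter 1, and the explicit formula gives this derivative as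
  \<open>q * H - Q\<close>.\<close>

lemma critical_point_on_ray:
  fixes z :: "'n::finite fpair"
  assumes "q > 0" and crit: "critical_point q J z"
    and J: "\<And>\<tau>. \<tau> > 0 \<Longrightarrow> J (pair_lincomb \<tau> z 0 z) = \<tau> powr q * H - \<tau>\<^sup>2 / 2 * Q"
  shows "q * H = Q"
proof -
  obtain u v where uv: "z = (u, v)" by (cases z)
  define g where "g = (\<lambda>\<tau>::real. \<tau> powr q * H - \<tau>\<^sup>2 / 2 * Q)"
  define n where "n = pair_norm q z"
  have n: "n \<ge> 0" by (simp add: n_def pair_norm_nonneg)
  have J1: "J z = g 1"
    using J[of 1] by (simp add: g_def uv pair_lincomb_scale)
  have "(g has_derivative (\<lambda>_. 0)) (at 1)"
    unfolding has_derivative_at_alt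
  proof (intro conjI allI impI)
    fix e :: real assume e: "e > 0"
    \<comment> \<open>Adding 1 to the norm \<open>n\<close> avoids division by zero when
      \<open>z\<close> has seminorm zero.\<close>
    define \<epsilon> where "\<epsilon> = e / (n + 1)"
    have "\<epsilon> > 0" using e n by (simp add: \<epsilon>_def)
    then obtain \<delta> where \<delta>: "\<delta> > 0" "\<And>w. w \<in> pair_space q \<Longrightarrow> pair_norm q w < \<delta> \<Longrightarrow>
        \<bar>J (pair_lincomb 1 z 1 w) - J z - 0\<bar> \<le> \<epsilon> * pair_norm q w"
      using crit unfolding critical_point_def has_frechet_derivative_on_pairs_def by meson
    show "\<exists>d>0. \<forall>y. norm (y - 1) < d \<longrightarrow> norm (g y - g 1 - 0) \<le> e * norm (y - 1)"
    proof (intro exI conjI allI impI)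
      \<comment> \<open>The bound 1 keeps \<open>y\<close> positive, where the formula for
        \<open>J\<close> is available.\<close>
      show "min 1 (\<delta> / (n + 1)) > 0" using \<delta> n by simp
      fix y :: real assume y: "norm (y - 1) < min 1 (\<delta> / (n + 1))"
      define w where "w = pair_lincomb (y - 1) z 0 z"
      have w: "w \<in> pair_space q"
        using crit by (auto simp: w_def uv pair_lincomb_scale pair_space_def critical_point_def Lspace_mult)
      have nw: "pair_norm q w = \<bar>y - 1\<bar> * n"
        using \<open>q > 0\<close> by (simp add: w_def uv pair_lincomb_scale n_def pair_norm_scale)
      have "\<bar>y - 1\<bar> * n \<le> \<bar>y - 1\<bar> * (n + 1)" by (intro mult_left_mono) auto
      also have "\<dots> < \<delta>" using y n by (simp add: pos_less_divide_eq)
      finally have "pair_norm q w < \<delta>" by (simp add: nw)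
      from \<delta>(2)[OF w this]
      have "\<bar>J (pair_lincomb 1 z 1 w) - J z\<bar> \<le> \<epsilon> * (\<bar>y - 1\<bar> * n)" by (simp add: nw)
      also have "pair_lincomb 1 z 1 w = pair_lincomb y z 0 z"
        by (simp add: w_def uv pair_lincomb_def algebra_simps)
      also have "J (pair_lincomb y z 0 z) = g y"
        using J[of y] y by (simp add: g_def abs_less_iff)
      also have "\<epsilon> * (\<bar>y - 1\<bar> * n) \<le> e * \<bar>y - 1\<bar>"
      proof -
        have "\<epsilon> * n \<le> e" using e n by (simp add: \<epsilon>_def field_simps)
        then have "\<epsilon> * n * \<bar>y - 1\<bar> \<le> e * \<bar>y - 1\<bar>" by (intro mult_right_mono) auto
        then show ?thesis by (simp add: mult_ac)
      qed
      finally show "norm (g y - g 1 - 0) \<le> e * norm (y - 1)" by (simp add: J1)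
    qed
  qed auto
  then have "(g has_real_derivative 0) (at 1)"
    by (simp add: has_field_derivative_def lambda_zero)
  moreover have "(g has_real_derivative q * H - Q) (at 1)"
    unfolding g_def by (auto intro!: derivative_eq_intros)
  ultimately show ?thesis using DERIV_unique by fastforce
qed

text \<open>Hoelder's inequality for two summands. The weights have norm 1 in the conjugate exponent
  and give equality at \<open>(f, g) = (A, B)\<close>; integrating this linear bound, with
  \<open>A\<close> and \<open>B\<close> the integrals of \<open>f\<close> and \<open>g\<close>,
  yields Minkowski's inequality.\<close>

lemma weighted_sum_le_powr_sum:
  fixes A B f g r :: real
  assumes r: "r > 1" and "A > 0" "B > 0" "f \<ge> 0" "g \<ge> 0"
    and M: "M = (A powr r + B powr r) powr (1 / r)"
  shows "(A / M) powr (r - 1) * f + (B / M) powr (r - 1) * g \<le> (f powr r + g powr r) powr (1 / r)"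
proof (cases "f = 0 \<and> g = 0")
  case False
  define N where "N = (f powr r + g powr r) powr (1 / r)"
  have sum: "f powr r + g powr r > 0"
    using False assms by (metis add_nonneg_pos add_pos_nonneg powr_ge_zero powr_gt_zero)
  then have N: "N > 0" by (simp add: N_def)
  have Nr: "N powr r = f powr r + g powr r"
    using sum r by (simp add: N_def powr_powr)
  have "A powr r + B powr r > 0" using assms by (simp add: add_pos_pos)
  then have Mpos: "M > 0" and Mr: "M powr r = A powr r + B powr r"
    using r by (simp_all add: M powr_powr)
  define r' where "r' = r / (r - 1)"
  have r': "r' > 1" "1 / r' + 1 / r = 1"
    using r by (auto simp: r'_def field_simps)
  have young: "(D / M) powr (r - 1) * (h / N) \<le> (D / M) powr r / r' + (h / N) powr r / r"
    if "D > 0" "h \<ge> 0" for D h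
  proof -
    have "(D / M) powr (r - 1) * (h / N) \<le> ((D / M) powr (r - 1)) powr r' / r' + (h / N) powr r / r"
      using that r r' N by (intro Youngs_inequality) auto
    also have "((D / M) powr (r - 1)) powr r' = (D / M) powr r"
      using r by (simp add: powr_powr r'_def)
    finally show ?thesis .
  qed
  have "(A / M) powr r + (B / M) powr r = 1"
    using assms Mpos Mr by (simp add: powr_divide flip: add_divide_distrib)
  moreover have "(f / N) powr r + (g / N) powr r = 1"
    using assms N Nr sum by (simp add: powr_divide flip: add_divide_distrib)
  ultimately have "((A / M) powr r + (B / M) powr r) / r' + ((f / N) powr r + (g / N) powr r) / r = 1"
    using r' by simp
  then have "(A / M) powr (r - 1) * (f / N) + (B / M) powr (r - 1) * (g / N) \<le> 1"
    using young[of A f] young[of B g] assms by (simp add: add_divide_distrib)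
  then have "((A / M) powr (r - 1) * f + (B / M) powr (r - 1) * g) / N \<le> 1"
    by (simp add: add_divide_distrib)
  then show ?thesis using N by (simp add: N_def)
qed auto

subsection \<open>The dual functional\<close>

locale dual_system =
  fixes a b :: "real ^ 'n::finite \<Rightarrow> real"
    and K L :: "(real ^ 'n \<Rightarrow> real) \<Rightarrow> real ^ 'n \<Rightarrow> real"
    and \<mu> \<nu> p q a\<^sub>0 :: real
  assumes p4: "p \<ge> 4" and q_def: "q = conj_exponent p"
    and meas [measurable]: "a \<in> borel_measurable lebesgue" "b \<in> borel_measurable lebesgue"
    and a0: "a\<^sub>0 > 0" "AE x in lebesgue. a\<^sub>0 \<le> a x"
    and b_bounds: "AE x in lebesgue. 0 \<le> b x \<and> b x < 2 powr ((p - 2) / 2) - 1"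
    and K: "helmholtz_conv \<mu> p K" and L: "helmholtz_conv \<nu> p L"
begin

lemma p1: "p > 1" using p4 by simp

lemmas q_facts = conj_exponent_identities[OF p1 q_def]

lemma q_less_2: "q < 2"
  using p4 by (simp add: q_def conj_exponent_def field_simps)

lemma AE_coeffs:
  "AE x in lebesgue. a\<^sub>0 \<le> a x \<and> a x > 0 \<and> b x \<ge> 0 \<and> b x < 2 powr ((p - 2) / 2) - 1"
  using a0(2) b_bounds by eventually_elim (use a0(1) in auto)

text \<open>\<open>wt x / q\<close> is the coefficient in the transform of the scalar function
  \<open>a x / p * \<bar>s\<bar> powr p\<close>.\<close>

definition wt :: "real ^ 'n \<Rightarrow> real" where
  "wt x = a x powr (1 - q)"

lemma wt_integrable:
  assumes "u \<in> Lspace q"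
  shows "integrable lebesgue (\<lambda>x. wt x * \<bar>u x\<bar> powr q)"
proof (rule Bochner_Integration.integrable_bound)
  show "integrable lebesgue (\<lambda>x. a\<^sub>0 powr (1 - q) * \<bar>u x\<bar> powr q)"
    using assms by (simp add: Lspace_def)
  have [measurable]: "u \<in> borel_measurable lebesgue" using assms by (simp add: Lspace_def)
  show "(\<lambda>x. wt x * \<bar>u x\<bar> powr q) \<in> borel_measurable lebesgue"
    unfolding wt_def by measurable
  show "AE x in lebesgue. norm (wt x * \<bar>u x\<bar> powr q) \<le> norm (a\<^sub>0 powr (1 - q) * \<bar>u x\<bar> powr q)"
    using a0(2)
  proof eventually_elim
    case (elim x)
    \<comment> \<open>The exponent \<open>1 - q\<close> is negative, so the lower bound on
      \<open>a\<close> bounds the weight from above.\<close>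
    have "wt x \<le> a\<^sub>0 powr (1 - q)"
      unfolding wt_def using elim a0(1) q_facts by (intro powr_mono2') auto
    then show ?case by (simp add: wt_def abs_mult mult_right_mono)
  qed
qed

definition mass :: "(real ^ 'n \<Rightarrow> real) \<Rightarrow> real" where
  "mass u = (\<integral>x. wt x * \<bar>u x\<bar> powr q \<partial>lebesgue)"

lemma mass_pos:
  assumes "u \<in> Lspace q" "\<not> zero_ae u"
  shows "mass u > 0"
proof -
  have "mass u \<noteq> 0"
  proof
    assume "mass u = 0"
    then have "AE x in lebesgue. wt x * \<bar>u x\<bar> powr q = 0"
      using integral_nonneg_eq_0_iff_AE[OF wt_integrable[OF assms(1)]]
      by (simp add: mass_def wt_def)
    then have "AE x in lebesgue. u x = 0"
      using AE_coeffs by eventually_elim (auto simp: wt_def)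
    with assms(2) show False by (simp add: zero_ae_def)
  qed
  moreover have "mass u \<ge> 0" by (simp add: mass_def wt_def)
  ultimately show ?thesis by simp
qed

section \<open>Integrability of the quadratic form and of the Legendre transform\<close>

lemma conv_mult:
  assumes "helmholtz_conv lam p G" "u \<in> Lspace q"
  shows "AE x in lebesgue. G (\<lambda>y. c * u y) x = c * G u x"
proof -
  have "AE x in lebesgue. G (\<lambda>y. c * u y + 0 * u y) x = c * G u x + 0 * G u x"
    using assms unfolding helmholtz_conv_def q_def by blast
  then show ?thesis by simp
qed

lemma conv_integrable:
  assumes "helmholtz_conv lam p G" "u \<in> Lspace q"
  shows "integrable lebesgue (\<lambda>x. u x * G u x)"
proof (rule Bochner_Integration.integrable_bound)
  have G: "G u \<in> Lspace p" using assms by (simp add: helmholtz_conv_def q_def)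
  show "integrable lebesgue (\<lambda>x. \<bar>u x\<bar> powr q / q + \<bar>G u x\<bar> powr p / p)"
    using assms G by (simp add: Lspace_def)
  show "(\<lambda>x. u x * G u x) \<in> borel_measurable lebesgue"
    using assms G by (intro borel_measurable_times) (auto simp: Lspace_def)
  show "AE x in lebesgue. norm (u x * G u x) \<le> norm (\<bar>u x\<bar> powr q / q + \<bar>G u x\<bar> powr p / p)"
  proof (rule AE_I2)
    fix x
    have "\<bar>u x\<bar> * \<bar>G u x\<bar> \<le> \<bar>u x\<bar> powr q / q + \<bar>G u x\<bar> powr p / p"
      using q_facts p1 by (intro Youngs_inequality) auto
    then show "norm (u x * G u x) \<le> norm (\<bar>u x\<bar> powr q / q + \<bar>G u x\<bar> powr p / p)"
      by (simp add: abs_mult)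
  qed
qed

text \<open>The supremum over all arguments agrees with the one over a countable dense set; the
  coefficients are first changed on a null set so that all these suprema are finite.\<close>

lemma legendre_measurable:
  assumes [measurable]: "u \<in> borel_measurable lebesgue" "v \<in> borel_measurable lebesgue"
  shows "(\<lambda>x. legendre a b p x (u x) (v x)) \<in> borel_measurable lebesgue"
proof -
  define a' b' where "a' = (\<lambda>x. max a\<^sub>0 (a x))" and "b' = (\<lambda>x. max 0 (b x))"
  have pos: "a' x > 0" "b' x \<ge> 0" for x using a0 by (auto simp: a'_def b'_def)
  have [measurable]: "a' \<in> borel_measurable lebesgue" "b' \<in> borel_measurable lebesgue"
    unfolding a'_def b'_def by measurable
  define F where "F = (\<lambda>z x. fst z * u x + snd z * v x - nonlin a' b' p x (fst z) (snd z))"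
  obtain D :: "(real \<times> real) set" where D: "countable D"
    "\<And>X. open X \<Longrightarrow> X \<noteq> {} \<Longrightarrow> \<exists>d\<in>D. d \<in> X"
    using countable_dense_exists[where 'a = "real \<times> real"] by blast
  then have "D \<noteq> {}" using D(2)[OF open_UNIV] by auto
  have bdd: "bdd_above (range (\<lambda>z. F z x))" for x
    using legendre_bdd_above[of p a' x b' "u x" "v x"] p1 pos
    by (simp add: F_def case_prod_beta')
  then have bddD: "bdd_above ((\<lambda>z. F z x) ` D)" for x
    by (rule bdd_above_mono) auto
  have eq: "legendre a' b' p x (u x) (v x) = (SUP z\<in>D. F z x)" for x
  proof -
    have "F z x \<le> (SUP z\<in>D. F z x)" for z
    proof (rule ccontr)
      \<comment> \<open>By continuity in \<open>z\<close>, an argument beating the supremum over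
        \<open>D\<close> would have a neighbour in \<open>D\<close> that beats it too.\<close>
      assume "\<not> ?thesis"
      then have "z \<in> {z. (SUP z\<in>D. F z x) < F z x}" by simp
      moreover have "open {z. (SUP z\<in>D. F z x) < F z x}"
        unfolding F_def nonlin_def
        by (intro open_Collect_less continuous_on_const continuous_on_diff continuous_on_add
            continuous_on_mult continuous_on_fst continuous_on_snd continuous_on_id
            continuous_on_powr' continuous_on_rabs) (use p1 in auto)
      ultimately obtain d where "d \<in> D" "(SUP z\<in>D. F z x) < F d x"
        using D(2) by blast
      with cSUP_upper[OF _ bddD] show False by (meson not_le)
    qed
    then have "(SUP z. F z x) \<le> (SUP z\<in>D. F z x)" by (intro cSUP_least) auto
    moreover have "(SUP z\<in>D. F z x) \<le> (SUP z. F z x)"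
      using \<open>D \<noteq> {}\<close> bdd by (intro cSUP_subset_mono) auto
    ultimately show ?thesis by (simp add: legendre_def F_def case_prod_beta')
  qed
  have "(\<lambda>x. SUP z\<in>D. F z x) \<in> borel_measurable lebesgue"
  proof (rule borel_measurable_cSUP[OF D(1) _ bddD])
    show "F z \<in> borel_measurable lebesgue" for z
      unfolding F_def nonlin_def by measurable
  qed
  then have "(\<lambda>x. legendre a' b' p x (u x) (v x)) \<in> borel_measurable lebesgue"
    by (simp add: eq)
  moreover have "AE x in lebesgue. legendre a' b' p x (u x) (v x) = legendre a b p x (u x) (v x)"
    using AE_coeffs
    by eventually_elim (auto simp: legendre_def nonlin_def a'_def b'_def max_def)
  ultimately show ?thesis by (rule borel_measurable_AE)
qed

lemma legendre_integrable:
  assumes "u \<in> Lspace q" "v \<in> Lspace q"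
  shows "integrable lebesgue (\<lambda>x. legendre a b p x (u x) (v x))"
proof (rule Bochner_Integration.integrable_bound)
  show "integrable lebesgue (\<lambda>x. (wt x * \<bar>u x\<bar> powr q + wt x * \<bar>v x\<bar> powr q) / q)"
    using assms wt_integrable by auto
  show "(\<lambda>x. legendre a b p x (u x) (v x)) \<in> borel_measurable lebesgue"
    using assms by (intro legendre_measurable) (auto simp: Lspace_def)
  show "AE x in lebesgue. norm (legendre a b p x (u x) (v x))
      \<le> norm ((wt x * \<bar>u x\<bar> powr q + wt x * \<bar>v x\<bar> powr q) / q)"
    using AE_coeffs
  proof eventually_elim
    case (elim x)
    then show ?case
      using legendre_upper[OF p1 _ _ q_def, of a x b "u x" "v x"]
        legendre_nonneg[OF p1, of a x b "u x" "v x"] q_facts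
      by (simp add: wt_def add_divide_distrib algebra_simps)
  qed
qed

section \<open>The functional along rays\<close>

abbreviation functional :: "'n fpair \<Rightarrow> real" where
  "functional \<equiv> dual_functional a b p K L"

definition form :: "((real ^ 'n \<Rightarrow> real) \<Rightarrow> real ^ 'n \<Rightarrow> real) \<Rightarrow> (real ^ 'n \<Rightarrow> real) \<Rightarrow> real" where
  "form G u = (\<integral>x. u x * G u x \<partial>lebesgue)"

lemma functional_ray:
  assumes "u \<in> Lspace q" "v \<in> Lspace q"
  shows "functional (pair_lincomb \<tau> (u, v) 0 (u, v)) =
    (\<integral>x. legendre a b p x (\<tau> * u x) (\<tau> * v x) \<partial>lebesgue) - \<tau>\<^sup>2 / 2 * (form K u + form L v)"
proof -
  have "(\<integral>x. (\<tau> * u x) * K (\<lambda>x. \<tau> * u x) x + (\<tau> * v x) * L (\<lambda>x. \<tau> * v x) x \<partial>lebesgue)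
      = (\<integral>x. \<tau>\<^sup>2 * (u x * K u x) + \<tau>\<^sup>2 * (v x * L v x) \<partial>lebesgue)"
  proof (rule integral_cong_AE)
    have sp: "(\<lambda>x. \<tau> * u x) \<in> Lspace q" "(\<lambda>x. \<tau> * v x) \<in> Lspace q"
      using assms by (auto intro: Lspace_mult)
    note ints = conv_integrable[OF K sp(1)] conv_integrable[OF L sp(2)]
      conv_integrable[OF K assms(1)] conv_integrable[OF L assms(2)]
    note [measurable] = ints[THEN borel_measurable_integrable]
    show "(\<lambda>x. (\<tau> * u x) * K (\<lambda>x. \<tau> * u x) x + (\<tau> * v x) * L (\<lambda>x. \<tau> * v x) x)
        \<in> borel_measurable lebesgue" by measurable
    show "(\<lambda>x. \<tau>\<^sup>2 * (u x * K u x) + \<tau>\<^sup>2 * (v x * L v x)) \<in> borel_measurable lebesgue"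
      by measurable
    show "AE x in lebesgue. (\<tau> * u x) * K (\<lambda>x. \<tau> * u x) x + (\<tau> * v x) * L (\<lambda>x. \<tau> * v x) x
        = \<tau>\<^sup>2 * (u x * K u x) + \<tau>\<^sup>2 * (v x * L v x)"
      using conv_mult[OF K assms(1), of \<tau>] conv_mult[OF L assms(2), of \<tau>]
      by eventually_elim (simp add: power2_eq_square)
  qed
  also have "\<dots> = \<tau>\<^sup>2 * (form K u + form L v)"
    using conv_integrable[OF K assms(1)] conv_integrable[OF L assms(2)]
    by (simp add: form_def distrib_left)
  finally show ?thesis
    by (simp add: pair_lincomb_scale dual_functional_def)
qed

lemma functional_ray_eq:
  assumes "u \<in> Lspace q" "v \<in> Lspace q" "\<tau> > 0"
  shows "functional (pair_lincomb \<tau> (u, v) 0 (u, v)) =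
    \<tau> powr q * (\<integral>x. legendre a b p x (u x) (v x) \<partial>lebesgue) - \<tau>\<^sup>2 / 2 * (form K u + form L v)"
proof -
  have "(\<integral>x. legendre a b p x (\<tau> * u x) (\<tau> * v x) \<partial>lebesgue)
      = (\<integral>x. \<tau> powr q * legendre a b p x (u x) (v x) \<partial>lebesgue)"
  proof (rule integral_cong_AE)
    show "(\<lambda>x. legendre a b p x (\<tau> * u x) (\<tau> * v x)) \<in> borel_measurable lebesgue"
      "(\<lambda>x. \<tau> powr q * legendre a b p x (u x) (v x)) \<in> borel_measurable lebesgue"
      using legendre_integrable[OF assms(1,2)] legendre_integrable[OF assms(1,2)[THEN Lspace_mult]]
      by auto
    show "AE x in lebesgue. legendre a b p x (\<tau> * u x) (\<tau> * v x)
        = \<tau> powr q * legendre a b p x (u x) (v x)"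
      using AE_coeffs
      by eventually_elim (rule legendre_scale[OF p1 _ _ q_def \<open>\<tau> > 0\<close>], auto)
  qed
  then show ?thesis by (simp add: functional_ray[OF assms(1,2)])
qed

text \<open>This majorant serves the rays through \<open>(u, 0)\<close> and \<open>(0, v)\<close>;
  it includes \<tau> = 0, where the mountain pass paths start.\<close>

lemma functional_ray_le:
  assumes "u \<in> Lspace q" "v \<in> Lspace q" "\<tau> \<ge> 0"
  shows "functional (pair_lincomb \<tau> (u, v) 0 (u, v)) \<le>
    \<tau> powr q * (mass u + mass v) / q - \<tau>\<^sup>2 / 2 * (form K u + form L v)"
proof -
  have "(\<integral>x. legendre a b p x (\<tau> * u x) (\<tau> * v x) \<partial>lebesgue)
      \<le> (\<integral>x. \<tau> powr q / q * (wt x * \<bar>u x\<bar> powr q + wt x * \<bar>v x\<bar> powr q) \<partial>lebesgue)"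
  proof (rule integral_mono_AE')
    show "integrable lebesgue (\<lambda>x. \<tau> powr q / q * (wt x * \<bar>u x\<bar> powr q + wt x * \<bar>v x\<bar> powr q))"
      using assms wt_integrable by auto
    show "AE x in lebesgue. legendre a b p x (\<tau> * u x) (\<tau> * v x)
        \<le> \<tau> powr q / q * (wt x * \<bar>u x\<bar> powr q + wt x * \<bar>v x\<bar> powr q)"
      using AE_coeffs
    proof eventually_elim
      case (elim x)
      then show ?case
        using legendre_upper[OF p1 _ _ q_def, of a x b "\<tau> * u x" "\<tau> * v x"] \<open>\<tau> \<ge> 0\<close>
        by (simp add: wt_def abs_mult powr_mult algebra_simps)
    qed
  qed (use q_facts in \<open>auto simp: wt_def\<close>)
  also have "\<dots> = \<tau> powr q * (mass u + mass v) / q"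
    using wt_integrable[OF assms(1)] wt_integrable[OF assms(2)] by (simp add: mass_def)
  finally show ?thesis by (simp add: functional_ray[OF assms(1,2)])
qed

text \<open>The Hoelder weights \<alpha>, \<beta> dual to the masses reduce the claim to a positive
  integral of \<phi>. This function is nonnegative almost everywhere and can vanish only where
  \<open>u\<close> does: if \<open>u x\<close> and \<open>v x\<close> are nonzero,
  \<open>legendre_lower\<close> is strict, and if only \<open>v x\<close> vanishes, \<alpha> < 1
  gives strictness.\<close>

lemma legendre_integral_gt:
  assumes u: "u \<in> Lspace q" "\<not> zero_ae u" and v: "v \<in> Lspace q" "\<not> zero_ae v"
  shows "(mass u powr (2 / q) + mass v powr (2 / q)) powr (q / 2)
    < q * (\<integral>x. legendre a b p x (u x) (v x) \<partial>lebesgue)"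
proof -
  define r where "r = 2 / q"
  have r: "r > 1" "1 / r = q / 2" "r - 1 > 0" using q_facts(1) q_less_2 by (auto simp: r_def)
  define A B where "A = mass u" and "B = mass v"
  have AB: "A > 0" "B > 0" using mass_pos u v by (auto simp: A_def B_def)
  define M where "M = (A powr r + B powr r) powr (1 / r)"
  have sum: "A powr r + B powr r > 0" using AB by (simp add: add_pos_pos)
  then have M: "M > 0" and Mr: "M powr r = A powr r + B powr r"
    using r by (simp_all add: M_def powr_powr)
  \<comment> \<open>Both masses are positive, so each is strictly smaller than \<open>M\<close>;
    this is what makes \<alpha> and \<beta> less than 1.\<close>
  have "A powr r < M powr r" "B powr r < M powr r" using Mr AB by auto
  then have "A < M" "B < M"
    using r(1) M powr_mono2[of r M A] powr_mono2[of r M B] by (auto simp: not_le[symmetric])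
  define \<alpha> \<beta> where "\<alpha> = (A / M) powr (r - 1)" and "\<beta> = (B / M) powr (r - 1)"
  have less1: "\<alpha> < 1" "\<beta> < 1"
    using powr_less_mono2[of "r - 1" "A / M" 1] powr_less_mono2[of "r - 1" "B / M" 1]
      \<open>A < M\<close> \<open>B < M\<close> AB M r by (auto simp: \<alpha>_def \<beta>_def)
  have "\<alpha> * A + \<beta> * B = (A powr r + B powr r) / M powr (r - 1)"
    using AB M by (simp add: \<alpha>_def \<beta>_def powr_divide powr_diff field_simps)
  also have "\<dots> = M" using M by (simp add: Mr[symmetric] powr_diff)
  finally have \<alpha>\<beta>: "\<alpha> * A + \<beta> * B = M" .
  define \<phi> where "\<phi> = (\<lambda>x. q * legendre a b p x (u x) (v x)
      - (\<alpha> * (wt x * \<bar>u x\<bar> powr q) + \<beta> * (wt x * \<bar>v x\<bar> powr q)))"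
  have int: "integrable lebesgue \<phi>"
    unfolding \<phi>_def using u v legendre_integrable wt_integrable by auto
  have "(\<integral>x. \<phi> x \<partial>lebesgue) = q * (\<integral>x. legendre a b p x (u x) (v x) \<partial>lebesgue) - M"
    unfolding \<phi>_def using u v legendre_integrable wt_integrable \<alpha>\<beta>
    by (simp add: mass_def A_def B_def)
  moreover have nonneg: "AE x in lebesgue. \<phi> x \<ge> 0 \<and> (\<phi> x = 0 \<longrightarrow> u x = 0)"
    using AE_coeffs
  proof eventually_elim
    case (elim x)
    define f g where "f = wt x * \<bar>u x\<bar> powr q" and "g = wt x * \<bar>v x\<bar> powr q"
    have fg: "f \<ge> 0" "g \<ge> 0" and wt: "wt x > 0"
      using elim by (auto simp: f_def g_def wt_def)
    define N where "N = wt x * ((u x)\<^sup>2 + (v x)\<^sup>2) powr (q / 2)"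
    have N: "(f powr r + g powr r) powr (1 / r) = N"
    proof -
      have pw: "(\<bar>y\<bar> powr q) powr r = y\<^sup>2" for y :: real
        using q_facts(1) by (cases "y = 0") (auto simp: powr_powr r_def)
      have "f powr r + g powr r = wt x powr r * ((u x)\<^sup>2 + (v x)\<^sup>2)"
        using wt by (simp add: f_def g_def powr_mult pw distrib_left)
      then have "(f powr r + g powr r) powr (1 / r) = wt x * ((u x)\<^sup>2 + (v x)\<^sup>2) powr (1 / r)"
        using wt r(1) by (simp add: powr_mult powr_powr)
      then show ?thesis by (simp only: r(2) N_def)
    qed
    have le: "\<alpha> * f + \<beta> * g \<le> N"
      using weighted_sum_le_powr_sum[OF r(1) AB fg M_def] by (simp add: \<alpha>_def \<beta>_def N)
    have leg: "N \<le> q * legendre a b p x (u x) (v x)"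
      "u x \<noteq> 0 \<Longrightarrow> v x \<noteq> 0 \<Longrightarrow> N < q * legendre a b p x (u x) (v x)"
      using legendre_lower[OF p4 _ _ _ q_def, of a x b "u x" "v x"] elim q_facts(1)
      by (auto simp: N_def wt_def field_simps)
    have "\<alpha> * f + \<beta> * g < N" if "v x = 0" "u x \<noteq> 0"
    proof -
      have "f > 0" using that wt by (simp add: f_def)
      moreover have "g = 0" using that by (simp add: g_def)
      ultimately have "N = f" using N r(1) by (simp add: powr_powr)
      with \<open>f > 0\<close> \<open>g = 0\<close> less1 show ?thesis by simp
    qed
    with le leg show ?case unfolding \<phi>_def f_def[symmetric] g_def[symmetric] by fastforce
  qed
  moreover have "(\<integral>x. \<phi> x \<partial>lebesgue) \<noteq> 0"
  proof
    assume "(\<integral>x. \<phi> x \<partial>lebesgue) = 0"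
    then have "AE x in lebesgue. \<phi> x = 0"
      using integral_nonneg_eq_0_iff_AE[OF int] nonneg by (simp add: eventually_conj_iff)
    then have "AE x in lebesgue. u x = 0" using nonneg by eventually_elim auto
    with u show False by (simp add: zero_ae_def)
  qed
  moreover have "(\<integral>x. \<phi> x \<partial>lebesgue) \<ge> 0"
    using nonneg by (intro integral_nonneg_AE) auto
  ultimately show ?thesis
    by (simp add: M_def A_def B_def r_def)
qed

section \<open>Ground states are semitrivial\<close>

lemma ground_state_semitrivial:
  assumes "dual_ground_state q functional z"
  shows "semitrivial z"
proof (rule ccontr)
  assume "\<not> semitrivial z"
  moreover obtain u v where z: "z = (u, v)" by (cases z)
  ultimately have nz: "\<not> zero_ae u" "\<not> zero_ae v" by (auto simp: semitrivial_def)
  have crit: "critical_point q functional (u, v)"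
    and level: "ereal (functional (u, v)) = mp_level q functional"
    using assms by (auto simp: dual_ground_state_def z)
  then have sp: "u \<in> Lspace q" "v \<in> Lspace q"
    by (auto simp: critical_point_def pair_space_def)
  define H Z where "H = (\<integral>x. legendre a b p x (u x) (v x) \<partial>lebesgue)" and "Z = q * H"
  note q = q_facts(1) q_less_2
  have Z: "Z = form K u + form L v"
    unfolding Z_def using functional_ray_eq[OF sp] q
    by (intro critical_point_on_ray[OF _ crit]) (auto simp: H_def)
  define S where "S = mass u powr (2 / q) + mass v powr (2 / q)"
  have mass: "mass u > 0" "mass v > 0" using mass_pos sp nz by auto
  have S: "S > 0" "S powr (q / 2) < Z"
    using legendre_integral_gt[OF sp(1) nz(1) sp(2) nz(2)] mass
    by (auto simp: S_def Z_def H_def add_pos_pos)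
  then have "Z > 0" by (smt (verit) powr_ge_zero)
  have "functional (u, v) = H - 1 / 2 * (form K u + form L v)"
    using functional_ray_eq[OF sp, of 1] by (simp add: pair_lincomb_scale H_def)
  also have "\<dots> = (1 / q - 1 / 2) * Z"
    using q by (simp add: Z[symmetric] left_diff_distrib) (simp add: Z_def)
  finally have level: "ereal ((1 / q - 1 / 2) * Z) = mp_level q functional"
    using level by simp
  \<comment> \<open>The integrand of \<open>form\<close> has the zero function itself as a factor,
    so the value of \<open>G\<close> there does not matter.\<close>
  have zero: "mass (\<lambda>x. 0) = 0" "form G (\<lambda>x. 0) = 0" for G
    by (simp_all add: mass_def form_def)
  have "form K u \<le> mass u powr (2 / q) * Z powr (1 - 2 / q)"
  proof (rule form_le_of_mp_level[OF q _ mass(1) \<open>Z > 0\<close> _ level])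
    show "(u, \<lambda>x. 0) \<in> pair_space q" using sp by (simp add: pair_space_def zero_in_Lspace)
    show "functional (pair_lincomb \<tau> (u, \<lambda>x. 0) 0 (u, \<lambda>x. 0))
        \<le> \<tau> powr q * mass u / q - \<tau>\<^sup>2 / 2 * form K u" if "\<tau> \<ge> 0" for \<tau>
      using functional_ray_le[OF sp(1) zero_in_Lspace that] by (simp add: zero)
  qed
  moreover have "form L v \<le> mass v powr (2 / q) * Z powr (1 - 2 / q)"
  proof (rule form_le_of_mp_level[OF q _ mass(2) \<open>Z > 0\<close> _ level])
    show "(\<lambda>x. 0, v) \<in> pair_space q" using sp by (simp add: pair_space_def zero_in_Lspace)
    show "functional (pair_lincomb \<tau> (\<lambda>x. 0, v) 0 (\<lambda>x. 0, v))
        \<le> \<tau> powr q * mass v / q - \<tau>\<^sup>2 / 2 * form L v" if "\<tau> \<ge> 0" for \<tau>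
      using functional_ray_le[OF zero_in_Lspace sp(2) that] by (simp add: zero)
  qed
  \<comment> \<open>Solving this for \<open>Z\<close> gives \<open>Z \<le> S powr (q / 2)\<close>,
    against the strict inequality in \<open>S\<close>.\<close>
  ultimately have "Z \<le> S * Z powr (1 - 2 / q)"
    unfolding S_def distrib_right using Z by linarith
  also have "\<dots> = S * Z / Z powr (2 / q)"
    using \<open>Z > 0\<close> by (simp add: powr_diff)
  finally have "Z powr (2 / q) \<le> S"
    using \<open>Z > 0\<close> by (simp add: pos_le_divide_eq)
  then have "(Z powr (2 / q)) powr (q / 2) \<le> S powr (q / 2)"
    using q by (intro powr_mono2) auto
  then have "Z \<le> S powr (q / 2)"
    using \<open>Z > 0\<close> q by (simp add: powr_powr)
  with S show False by simp
qed

end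

theorem theorem3:
  fixes a b :: "real ^ 'n \<Rightarrow> real"
    and K\<^sub>\<mu> K\<^sub>\<nu> :: "(real ^ 'n \<Rightarrow> real) \<Rightarrow> real ^ 'n \<Rightarrow> real"
    and \<mu> \<nu> p a\<^sub>0 :: real
  assumes "CARD('n) \<ge> 2"
    and "\<mu> > 0" and "\<nu> > 0"
    and "2 * (real CARD('n) + 1) / (real CARD('n) - 1) < p"
    and "ereal p < crit_exponent CARD('n)"
    and "a \<in> Linfty" and "b \<in> Linfty"
    and "Zn_periodic a" and "Zn_periodic b"
    and "AE x in lebesgue. 0 \<le> b x \<and> b x \<le> p - 1"
    and "a\<^sub>0 > 0" and "AE x in lebesgue. a\<^sub>0 \<le> a x"
    and "p \<ge> 4"
    and "0 \<le> esssup lebesgue (\<lambda>x. ereal (b x))"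
    and "esssup lebesgue (\<lambda>x. ereal (b x)) < ereal (2 powr ((p - 2) / 2) - 1)"
    and "helmholtz_conv \<mu> p K\<^sub>\<mu>" and "helmholtz_conv \<nu> p K\<^sub>\<nu>"
  shows "\<forall>z. dual_ground_state (conj_exponent p) (dual_functional a b p K\<^sub>\<mu> K\<^sub>\<nu>) z \<longrightarrow> semitrivial z"
proof -
  \<comment> \<open>A function is almost everywhere at most its essential supremum, so the strict
    bound passes to \<open>b\<close> pointwise.\<close>
  have "AE x in lebesgue. 0 \<le> b x \<and> b x < 2 powr ((p - 2) / 2) - 1"
    using assms(10) esssup_AE[of "\<lambda>x. ereal (b x)" lebesgue]
  proof eventually_elim
    case (elim x)
    with assms(15) have "ereal (b x) < ereal (2 powr ((p - 2) / 2) - 1)"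
      using le_less_trans by blast
    with elim show ?case by simp
  qed
  then interpret dual_system a b K\<^sub>\<mu> K\<^sub>\<nu> \<mu> \<nu> p "conj_exponent p" a\<^sub>0
    using assms by unfold_locales (auto simp: Linfty_def)
  show ?thesis using ground_state_semitrivial by blast
qed

end
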